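(* Let $n\ge 1$ be an integer, let $V$ be an $F_2$-vector space of dimension $2n$ with a nondegenerate symplectic form $\langle\,,\rangle: V\times V\to F_2$, and let $\{e_i; i\in S\}$ be a circular basis of $V$. Then $V$ is the disjoint union of the subsets $V^{B'}$ indexed by $B'\in\phi'(V)$: $$V=\bigsqcup_{B'\in\phi'(V)}V^{B'}.$$ That is, every vector of $V$ belongs to $V^{B'}$ for exactly one $B'\in\phi'(V)$.
   Context: $F_2$ is the field with two elements; a symplectic form is a bilinear form with $\langle x,x\rangle=0$ for all $x$. Circular basis: a family of vectors $\{e_i; i\in S\}$ of $V$ such that the graph with vertex set $S$, in which distinct $i,j\in S$ are joined exactly when $\langle e_i,e_j\rangle=1$, is a graph of affine type $A_{2n}$, i.e. a cycle with $2n+1$ vertices (so $|S|=2n+1$). In this situation $\sum_{i\in S}e_i=0$ and any $2n$ of the vectors $e_i$ form a basis of $V$. For $I\subset S$, $\underline{I}$ denotes the full (induced) subgraph of this graph with vertex set $I$. Let $\mathcal{I}^1$ be the set of all $I\subset S$ such that $\underline{I}$ is a graph of type $A_{2m+1}$ for some integer $m\ge 0$, i.e. a path with $2m+1$ vertices (a single vertex if $m=0$). For $I\in\mathcal{I}^1$ let $\delta I=\{s\in I;\ \underline{I-\{s\}}\text{ is connected or empty}\}$, i.e. the set of endpoints of the path. Dyck maps: for $I\in\mathcal{I}^1$, $Dy(I)$ is the set of all maps $f:I\to\mathbf{Z}_{\ge 1}$ such that $f(i)=1$ for all $i\in\delta I$, and $f(i)-f(i')\in\{1,-1\}$ whenever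 $i,i'$ are joined in $\underline{I}$. For $r\in\mathbf{Z}$ define $[r]\in F_2$ by $[r]=1$ if $r\equiv 1$ or $2 \pmod 4$, and $[r]=0$ if $r\equiv 3$ or $0\pmod 4$. For $I\in\mathcal{I}^1$, $Dy_2(I)$ is the set of all maps $g:I\to F_2$ for which there exists $f\in Dy(I)$ with $g(i)=[f(i)]$ for all $i\in I$. For $I,I'\in\mathcal{I}^1$ write $I\spadesuit I'$ if $I\cap I'=\emptyset$ and $\underline{I\cup I'}$ is disconnected. Let $\phi'(V)$ be the set of all finite subsets $B'$ of $\mathcal{I}^1$ (including the empty set) such that for any $I,I'\in B'$ one has $I=I'$ or $I\spadesuit I'$. For $B'\in\phi'(V)$, $V^{B'}$ is the subset of $V$ consisting of all vectors of the form $\sum_{I\in B'}\sum_{i\in I}g_I(i)e_i$ for $(g_I)_{I\in B'}\in\prod_{I\in B'}Dy_2(I)$ (so $V^{\emptyset}=\{0\}$). *)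

theory Defs
  imports "Graph_Theory.Digraph_Component" "HOL-Library.Z2" "HOL-Library.FuncSet"
begin

text \<open>The field with two elements is the type \<^typ>\<open>bit\<close>. The space \<open>V\<close> is a whole type, with scalar
  multiplication \<open>scale\<close>. Undirected graphs are symmetric digraphs in the sense of the
  \<open>Graph_Theory\<close> entry; note that its predicate \<open>connected\<close> is false for the empty graph.\<close>

definition symplectic_form :: "(bit \<Rightarrow> 'v \<Rightarrow> 'v) \<Rightarrow> ('v::ab_group_add \<Rightarrow> 'v \<Rightarrow> bit) \<Rightarrow> bool" where
  "symplectic_form scale \<omega> \<longleftrightarrow>
     (\<forall>x. Vector_Spaces.linear scale (*) (\<lambda>y. \<omega> x y)) \<and>
     (\<forall>y. Vector_Spaces.linear scale (*) (\<lambda>x. \<omega> x y)) \<and>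
     (\<forall>x. \<omega> x x = 0)"

definition nondegenerate :: "('v::zero \<Rightarrow> 'v \<Rightarrow> bit) \<Rightarrow> bool" where
  "nondegenerate \<omega> \<longleftrightarrow> (\<forall>x. (\<forall>y. \<omega> x y = 0) \<longrightarrow> x = 0)"

definition form_graph :: "('v \<Rightarrow> 'v \<Rightarrow> bit) \<Rightarrow> 's set \<Rightarrow> ('s \<Rightarrow> 'v) \<Rightarrow> ('s, 's \<times> 's) pre_digraph" where
  "form_graph \<omega> S e =
     with_proj \<lparr> pverts = S, parcs = {(i, j). i \<in> S \<and> j \<in> S \<and> i \<noteq> j \<and> \<omega> (e i) (e j) = 1} \<rparr>"

text \<open>\<open>is_cycle_graph N G\<close> is meaningful for \<open>N \<ge> 3\<close> (affine type \<open>A\<^sub>N\<^sub>-\<^sub>1\<close>);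
  \<open>is_path_graph N G\<close> is type \<open>A\<^sub>N\<close>.\<close>

definition is_cycle_graph :: "nat \<Rightarrow> ('s, 'a) pre_digraph \<Rightarrow> bool" where
  "is_cycle_graph N G \<longleftrightarrow>
     (\<exists>c. bij_betw c {..<N} (verts G) \<and>
          (\<forall>a<N. \<forall>b<N. (c a, c b) \<in> arcs_ends G \<longleftrightarrow> b = (a + 1) mod N \<or> a = (b + 1) mod N))"

definition is_path_graph :: "nat \<Rightarrow> ('s, 'a) pre_digraph \<Rightarrow> bool" where
  "is_path_graph N G \<longleftrightarrow>
     (\<exists>c. bij_betw c {..<N} (verts G) \<and>
          (\<forall>a<N. \<forall>b<N. (c a, c b) \<in> arcs_ends G \<longleftrightarrow> b = a + 1 \<or> a = b + 1))"

text \<open>In a nondegenerate symplectic space of dimension \<open>2 * n\<close>, the condition below implies that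
  the \<open>2 * n + 1\<close> vectors sum to zero and that any \<open>2 * n\<close> of them form a basis.\<close>

definition circular_basis :: "('v \<Rightarrow> 'v \<Rightarrow> bit) \<Rightarrow> nat \<Rightarrow> 's set \<Rightarrow> ('s \<Rightarrow> 'v) \<Rightarrow> bool" where
  "circular_basis \<omega> n S e \<longleftrightarrow> is_cycle_graph (2 * n + 1) (form_graph \<omega> S e)"

definition odd_paths :: "('s, 'a) pre_digraph \<Rightarrow> 's set set" where
  "odd_paths G = {I. I \<subseteq> verts G \<and> (\<exists>m. is_path_graph (2 * m + 1) (G \<restriction> I))}"

definition path_ends :: "('s, 'a) pre_digraph \<Rightarrow> 's set \<Rightarrow> 's set" where
  "path_ends G I =
     {s \<in> I. Digraph_Component.connected (G \<restriction> (I - {s})) \<or> I - {s} = {}}"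

text \<open>Maps defined on \<open>I\<close> are extensional functions, so equal maps are equal as HOL functions.\<close>

definition Dy :: "('s, 'a) pre_digraph \<Rightarrow> 's set \<Rightarrow> ('s \<Rightarrow> int) set" where
  "Dy G I = {f \<in> I \<rightarrow>\<^sub>E {1..}.
     (\<forall>i \<in> path_ends G I. f i = 1) \<and>
     (\<forall>i i'. (i, i') \<in> arcs_ends (G \<restriction> I) \<longrightarrow> f i - f i' \<in> {1, -1})}"

definition br :: "int \<Rightarrow> bit" where
  "br r = (if r mod 4 = 1 \<or> r mod 4 = 2 then 1 else 0)"

definition Dy2 :: "('s, 'a) pre_digraph \<Rightarrow> 's set \<Rightarrow> ('s \<Rightarrow> bit) set" where
  "Dy2 G I = {g \<in> I \<rightarrow>\<^sub>E UNIV. \<exists>f \<in> Dy G I. \<forall>i \<in> I. g i = br (f i)}"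

definition spade :: "('s, 'a) pre_digraph \<Rightarrow> 's set \<Rightarrow> 's set \<Rightarrow> bool" where
  "spade G I I' \<longleftrightarrow> I \<inter> I' = {} \<and> \<not> Digraph_Component.connected (G \<restriction> (I \<union> I'))"

definition phi' :: "('s, 'a) pre_digraph \<Rightarrow> 's set set set" where
  "phi' G = {B. finite B \<and> B \<subseteq> odd_paths G \<and> (\<forall>I \<in> B. \<forall>I' \<in> B. I = I' \<or> spade G I I')}"

definition piece ::
  "(bit \<Rightarrow> 'v \<Rightarrow> 'v) \<Rightarrow> ('s, 'a) pre_digraph \<Rightarrow> ('s \<Rightarrow> 'v::ab_group_add) \<Rightarrow> 's set set \<Rightarrow> 'v set" where
  "piece scale G e B = {\<Sum>I\<in>B. \<Sum>i\<in>I. scale (g I i) (e i) |g. g \<in> (\<Pi>\<^sub>E I\<in>B. Dy2 G I)}"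

end

theory Submission
  imports Defs
begin

text \<open>A vector is a function \<open>x\<close> from the cycle of odd length \<open>N = 2 n + 1\<close> to the two-element field,
  determined up to adding the constant 1. A family of Dyck maps on pairwise separated odd paths,
  extended by 0, is a nonnegative \<open>N\<close>-periodic function \<open>u\<close> on positions whose steps are \<open>\<plusminus>1\<close>, except that
  it may stay at 0. As \<open>[r] = [-1 - r]\<close>, unfolding \<open>u\<close> by the reflection \<open>r \<mapsto> -1 - r\<close> gives a walk \<open>h\<close> with all
  steps \<open>\<plusminus>1\<close>, with \<open>h k \<equiv> k\<close> modulo 2, with \<open>[h k] = [u k]\<close> and, since \<open>N\<close> is odd, with \<open>h (k + N) = -1 - h k\<close>.
  A residue modulo 4 is determined by its parity and its bracket, so the function \<open>x\<close> determines
  all steps of \<open>h\<close>, and the antiperiodicity then fixes the additive constant. Conversely the walk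
  built from \<open>x\<close> satisfies \<open>h (k + N) + h k = c\<close> with \<open>c \<equiv> 3\<close> modulo 4; shifting it by the even number
  \<open>(c + 1) div 2\<close> makes it antiperiodic, at the cost of possibly complementing \<open>x\<close>. The set \<open>B'\<close> is
  recovered from \<open>u\<close> as the set of components of its support.\<close>

subsection \<open>Reflected walks\<close>

text \<open>The reflection swaps the residues 1 and 2 modulo 4 and swaps 0 and 3, so it preserves
  both fibres of the bracket.\<close>

lemma br_reflect: "br (- 1 - r) = br r"
proof -
  have "(- 1 - r) mod 4 = 1 \<or> (- 1 - r) mod 4 = 2 \<longleftrightarrow> r mod 4 = 1 \<or> r mod 4 = 2"
    by presburger
  then show ?thesis by (simp add: br_def)
qed

lemma br_eq_1_iff: "br r = 1 \<longleftrightarrow> r mod 4 = 1 \<or> r mod 4 = 2"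
  by (simp add: br_def)

text \<open>Each parity class contains two residues modulo 4, and the bracket separates them: 0 from
  2, and 3 from 1.\<close>

lemma br_eq_iff:
  assumes "even (r - s)"
  shows "br r = br s \<longleftrightarrow> 4 dvd r - s"
proof -
  have "(r mod 4 = 1 \<or> r mod 4 = 2 \<longleftrightarrow> s mod 4 = 1 \<or> s mod 4 = 2) \<longleftrightarrow> 4 dvd r - s"
    using assms by presburger
  moreover have "br r = br s \<longleftrightarrow> (br r = 1 \<longleftrightarrow> br s = 1)"
    by (cases "br r"; cases "br s") simp_all
  ultimately show ?thesis by (simp add: br_eq_1_iff)
qed

definition dyck_walk :: "(nat \<Rightarrow> int) \<Rightarrow> bool" where
  "dyck_walk u \<longleftrightarrow> (\<forall>k. u k \<ge> 0 \<and> (\<bar>u (Suc k) - u k\<bar> = 1 \<or> u k = 0 \<and> u (Suc k) = 0))"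

text \<open>The numbers \<open>u k\<close> and \<open>- 1 - u k\<close> have opposite parities, so
  exactly one of them agrees with \<open>k\<close> modulo 2. A stay of \<open>u\<close> at 0 thereby
  becomes a crossing between 0 and -1.\<close>

definition unreflect :: "(nat \<Rightarrow> int) \<Rightarrow> nat \<Rightarrow> int" where
  "unreflect u k = (if even (u k - int k) then u k else - 1 - u k)"

lemma unreflect_parity: "even (unreflect u k - int k)"
  by (auto simp: unreflect_def)

lemma br_unreflect: "br (unreflect u k) = br (u k)"
  by (simp add: unreflect_def br_reflect)

lemma unreflect_step:
  assumes "dyck_walk u"
  shows "\<bar>unreflect u (Suc k) - unreflect u k\<bar> = 1"
proof -
  have "\<bar>u (Suc k) - u k\<bar> = 1 \<or> u k = 0 \<and> u (Suc k) = 0"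
    using assms by (simp add: dyck_walk_def)
  then consider "u (Suc k) = u k + 1" | "u (Suc k) = u k - 1" | "u k = 0" "u (Suc k) = 0"
    by linarith
  then show ?thesis by cases (auto simp: unreflect_def)
qed

lemma unreflect_antiperiodic:
  assumes "odd N" and "u (k + N) = u k"
  shows "unreflect u (k + N) = - 1 - unreflect u k"
  using assms by (auto simp: unreflect_def)

lemma unreflect_inverse:
  assumes "u k \<ge> 0"
  shows "u k = (if unreflect u k \<ge> 0 then unreflect u k else - 1 - unreflect u k)"
  using assms by (auto simp: unreflect_def)

text \<open>The difference \<open>D\<close> of the unfolded walks is even and moves by at most 2. By
  \<open>br_eq_iff\<close>, divisibility of \<open>D k\<close> by 4 does not depend on
  \<open>k\<close>, so a move by 2 is impossible. Complementary brackets are allowed because a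
  vector fixes its coordinates only up to adding 1.\<close>

lemma dyck_walk_unique:
  assumes "odd N" and u: "dyck_walk u" "\<And>k. u (k + N) = u k"
    and v: "dyck_walk v" "\<And>k. v (k + N) = v k"
    and br: "(\<forall>k. br (u k) = br (v k)) \<or> (\<forall>k. br (u k) \<noteq> br (v k))"
  shows "u = v"
proof -
  define D where "D k = unreflect u k - unreflect v k" for k
  have even_D: "even (D k)" for k
    using unreflect_parity[of u k] unreflect_parity[of v k] unfolding D_def by presburger
  have dvd_D: "4 dvd D k \<longleftrightarrow> br (u k) = br (v k)" for k
    using br_eq_iff even_D br_unreflect unfolding D_def by metis
  have step: "D (Suc k) = D k" for k
  proof -
    have "4 dvd D (Suc k) \<longleftrightarrow> 4 dvd D k" using dvd_D br by blast
    moreover have "\<bar>D (Suc k) - D k\<bar> \<le> 2"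
      using unreflect_step[OF u(1), of k] unreflect_step[OF v(1), of k]
      unfolding D_def by linarith
    ultimately show ?thesis using even_D[of k] even_D[of "Suc k"] by presburger
  qed
  have const: "D k = D 0" for k by (induction k) (simp_all add: step)
  \<comment> \<open>The constants -1 of the two reflections cancel, so \<open>D\<close> only changes
    sign after a full turn; being constant, it is 0.\<close>
  have "D (0 + N) = - D 0"
    using unreflect_antiperiodic[of N u 0] unreflect_antiperiodic[of N v 0] u(2)[of 0] v(2)[of 0] \<open>odd N\<close>
    unfolding D_def by simp
  then have "D k = 0" for k using const[of k] const[of "0 + N"] by simp
  then have "unreflect u k = unreflect v k" for k by (simp add: D_def)
  moreover have "u k \<ge> 0" "v k \<ge> 0" for k using u v by (auto simp: dyck_walk_def)
  ultimately show ?thesis using unreflect_inverse by (metis ext)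
qed

text \<open>Without zeros there are no stays, so every step flips the parity; an odd period rules
  this out.\<close>

lemma dyck_walk_zero:
  assumes "odd N" "dyck_walk u" "\<And>k. u (k + N) = u k"
  shows "\<exists>k. u k = 0"
proof (rule ccontr)
  assume nz: "\<nexists>k. u k = 0"
  have step: "even (u (Suc k) - u k - 1)" for k
  proof -
    have "\<bar>u (Suc k) - u k\<bar> = 1" using nz assms(2) unfolding dyck_walk_def by blast
    then have "u (Suc k) = u k + 1 \<or> u (Suc k) = u k - 1" by linarith
    then show ?thesis by auto
  qed
  have "even (u k - u 0 - int k)" for k
  proof (induction k)
    case (Suc k)
    have "u (Suc k) - u 0 - int (Suc k) = (u k - u 0 - int k) + (u (Suc k) - u k - 1)" by simp
    then show ?case using dvd_add[OF Suc.IH step[of k]] by (simp only:)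
  qed simp
  from this[of N] show False using assms(3)[of 0] \<open>odd N\<close> by simp
qed

text \<open>The value of \<open>bit_residue k b\<close> is the residue modulo 4 with the parity of \<open>k\<close> at which
  \<^const>\<open>br\<close> takes the value \<open>b\<close>.\<close>

definition bit_residue :: "nat \<Rightarrow> bit \<Rightarrow> int" where
  "bit_residue k b = (if even k then if b = 0 then 0 else 2 else if b = 0 then 3 else 1)"

lemma dyck_walk_exists:
  fixes x :: "nat \<Rightarrow> bit"
  assumes "odd N" and per: "\<And>k. x (k + N) = x k"
  shows "\<exists>u. dyck_walk u \<and> (\<forall>k. u (k + N) = u k) \<and>
           ((\<forall>k. br (u k) = x k) \<or> (\<forall>k. br (u k) = x k + 1))"
proof -
  define r where "r k = bit_residue k (x k)" for k
  \<comment> \<open>Consecutive residues differ by an odd number, which is 1 or -1 modulo 4;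
    \<open>d\<close> is that representative.\<close>
  define d where "d k = (if (r (Suc k) - r k) mod 4 = 1 then 1 else - 1 :: int)" for k
  define h where "h k = r 0 + (\<Sum>j<k. d j)" for k
  have h_0: "h 0 = r 0" and h_Suc: "h (Suc k) = h k + d k" for k
    by (simp_all add: h_def)
  have r_parity: "even (r k - int k)" for k
    by (auto simp: r_def bit_residue_def)
  have d_r: "4 dvd r (Suc k) - r k - d k" for k
    using r_parity[of k] r_parity[of "Suc k"] unfolding d_def by (simp split: if_splits) presburger
  have h_r: "4 dvd h k - r k" for k
  proof (induction k)
    case (Suc k)
    have "h (Suc k) - r (Suc k) = (h k - r k) - (r (Suc k) - r k - d k)" by (simp add: h_Suc)
    then show ?case using dvd_diff[OF Suc.IH d_r[of k]] by (simp only:)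
  qed (simp add: h_0)
  \<comment> \<open>The bit stays the same while the parity of the position flips, which exchanges 0
    with 3 and 1 with 2.\<close>
  have r_per: "r (k + N) = 3 - r k" for k
    using \<open>odd N\<close> per[of k] by (auto simp: r_def bit_residue_def)
  have d_per: "d (k + N) = - d k" for k
  proof -
    have neg: "r (Suc (k + N)) - r (k + N) = - (r (Suc k) - r k)"
      using r_per[of k] r_per[of "Suc k"] by simp
    have "(- t) mod 4 = 1 \<longleftrightarrow> t mod 4 \<noteq> 1" if "odd t" for t :: int
      using that by presburger
    moreover have "odd (r (Suc k) - r k)"
      using r_parity[of k] r_parity[of "Suc k"] by simp
    ultimately have "(- (r (Suc k) - r k)) mod 4 = 1 \<longleftrightarrow> (r (Suc k) - r k) mod 4 \<noteq> 1"
      by blast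
    then show ?thesis unfolding d_def neg by (simp only: if_not_P split: if_splits) simp
  qed
  have h_per: "h (k + N) + h k = h N + h 0" for k
    by (induction k) (simp_all add: h_Suc d_per)
  \<comment> \<open>Replacing \<open>h\<close> by \<open>h - a\<close> lowers the constant
    \<open>h N + h 0\<close> by \<open>2 * a\<close>, and the target value is -1. The constant is 3
    modulo 4 since \<open>r N + r 0 = 3\<close>, which makes \<open>a\<close> an even
    integer.\<close>
  define a where "a = (h N + h 0 + 1) div 2"
  have "4 dvd (h N - r N) + (h 0 - r 0)" by (intro dvd_add h_r)
  then have a: "even a" "h N + h 0 = 2 * a - 1"
    using r_per[of 0] unfolding a_def by simp_all presburger+
  define w where "w k = h k - a" for k
  define u where "u k = (if w k \<ge> 0 then w k else - 1 - w k)" for k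
  have w_step: "\<bar>w (Suc k) - w k\<bar> = 1" for k by (simp add: w_def h_Suc d_def)
  have w_per: "w (k + N) = - 1 - w k" for k
    using h_per[of k] a(2) unfolding w_def by linarith
  have br_r: "br (r k) = x k" for k by (auto simp: r_def bit_residue_def br_def)
  have br_u: "br (u k) = br (h k - a)" for k by (simp add: u_def w_def br_reflect)
  have "dyck_walk u"
    unfolding dyck_walk_def
  proof
    fix k
    show "u k \<ge> 0 \<and> (\<bar>u (Suc k) - u k\<bar> = 1 \<or> u k = 0 \<and> u (Suc k) = 0)"
      using w_step[of k] unfolding u_def by (auto simp: abs_if split: if_splits)
  qed
  moreover have "\<forall>k. u (k + N) = u k" using w_per by (simp add: u_def)
  moreover have "(\<forall>k. br (u k) = x k) \<or> (\<forall>k. br (u k) = x k + 1)"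
  \<comment> \<open>A shift by a multiple of 4 keeps all brackets; a shift by 2 modulo 4 complements
    all of them.\<close>
  proof (cases "4 dvd a")
    case True
    have "br (u k) = x k" for k
    proof -
      have "4 dvd h k - a - r k" "even (h k - a - r k)"
        using h_r[of k] True by presburger+
      then have "br (h k - a) = br (r k)" using br_eq_iff by blast
      then show ?thesis by (simp add: br_u br_r)
    qed
    then show ?thesis by blast
  next
    case False
    have "br (u k) = x k + 1" for k
    proof -
      have "\<not> 4 dvd h k - a - r k" "even (h k - a - r k)"
        using h_r[of k] False a(1) by presburger+
      then have "br (h k - a) \<noteq> br (r k)" using br_eq_iff by blast
      then show ?thesis by (cases "x k"; cases "br (u k)") (simp_all add: br_u br_r)
    qed
    then show ?thesis by blast
  qed
  ultimately show ?thesis by blast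
qed

subsection \<open>Odd paths in a cycle\<close>

lemma arcs_ends_induce_subgraph:
  "(u, v) \<in> arcs_ends (G \<restriction> T) \<longleftrightarrow> (u, v) \<in> arcs_ends G \<and> u \<in> T \<and> v \<in> T"
  by (auto simp: arcs_ends_conv)

text \<open>Trades reachability for cuts. The set of vertices reachable from a given one is closed
  under arcs; conversely, a closed set contains everything reachable from its members. Later proofs
  of connectedness or its failure only handle closed sets.\<close>

lemma connected_induce_subgraph_iff:
  assumes "symmetric G"
  shows "Digraph_Component.connected (G \<restriction> T) \<longleftrightarrow>
    T \<noteq> {} \<and> (\<forall>U \<subseteq> T. U \<noteq> {} \<longrightarrow> (\<forall>u \<in> U. \<forall>v \<in> T. (u, v) \<in> arcs_ends G \<longrightarrow> v \<in> U) \<longrightarrow> U = T)"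
    (is "?L \<longleftrightarrow> T \<noteq> {} \<and> ?R")
proof -
  define R where "R = arcs_ends G \<inter> T \<times> T"
  have parcs: "parcs (mk_symmetric (G \<restriction> T)) = R"
  proof -
    have "parcs (mk_symmetric (G \<restriction> T)) = arcs_ends (G \<restriction> T) \<union> (arcs_ends (G \<restriction> T))\<inverse>"
      by (auto simp: parcs_mk_symmetric arcs_ends_conv)
    then show ?thesis
      using arcs_ends_symmetric[OF assms] by (auto simp: R_def arcs_ends_induce_subgraph)
  qed
  have conn: "?L \<longleftrightarrow> T \<noteq> {} \<and> (\<forall>u\<in>T. \<forall>v\<in>T. (u, v) \<in> rtrancl_on T R)"
    by (simp add: connected_def strongly_connected_def reachable_def parcs)
  have "(u, v) \<in> rtrancl_on T R"
    if R: ?R and "u \<in> T" "v \<in> T" for u v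
  proof -
    have "{w \<in> T. (u, w) \<in> rtrancl_on T R} = T"
      using \<open>u \<in> T\<close> by (intro R[rule_format])
        (auto simp: R_def intro: rtrancl_on_into_rtrancl_on)
    then show ?thesis using \<open>v \<in> T\<close> by blast
  qed
  moreover have ?R if reach: "\<forall>u\<in>T. \<forall>v\<in>T. (u, v) \<in> rtrancl_on T R"
  proof (intro allI impI)
    fix U assume U: "U \<subseteq> T" "U \<noteq> {}" "\<forall>u\<in>U. \<forall>v\<in>T. (u, v) \<in> arcs_ends G \<longrightarrow> v \<in> U"
    then obtain u where u: "u \<in> U" by blast
    have "v \<in> U" if "(u, v) \<in> rtrancl_on T R" for v
      using that by (induction rule: rtrancl_on_induct) (use u U(3) in \<open>auto simp: R_def\<close>)
    then show "U = T" using reach u U(1) by blast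
  qed
  ultimately show ?thesis using conn by blast
qed

text \<open>A closed set contains \<open>p j\<close> exactly when it contains
  \<open>p (Suc j)\<close>, so it contains all of the sequence or nothing.\<close>

lemma connected_sequence:
  assumes "symmetric G" and "M > 0" and "\<And>j. Suc j < M \<Longrightarrow> (p j, p (Suc j)) \<in> arcs_ends G"
  shows "Digraph_Component.connected (G \<restriction> (p ` {..<M}))"
proof -
  have "U = p ` {..<M}"
    if U: "U \<subseteq> p ` {..<M}" "U \<noteq> {}"
      and cl: "\<forall>u\<in>U. \<forall>v\<in>p ` {..<M}. (u, v) \<in> arcs_ends G \<longrightarrow> v \<in> U" for U
  proof -
    obtain l where l: "l < M" "p l \<in> U" using U by blast
    have step: "p j \<in> U \<longleftrightarrow> p (Suc j) \<in> U" if "Suc j < M" for j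
      using cl assms(3)[OF that] arcs_ends_symmetric[OF assms(1)] that
      by (meson Suc_lessD imageI lessThan_iff)
    have "p j \<in> U \<longleftrightarrow> p 0 \<in> U" if "j < M" for j
      using that by (induction j) (use step in auto)
    then show ?thesis using l U(1) by blast
  qed
  then show ?thesis
    using assms(1,2) by (auto simp: connected_induce_subgraph_iff)
qed

text \<open>The numbering \<open>C\<close> is periodic on all naturals instead of a bijection from
  \<open>{..<N}\<close>, so that walks can run past a full turn and neighbours are reached by
  \<open>Suc\<close>.\<close>

locale cycle_graph =
  fixes G :: "('s, 'a) pre_digraph" and C :: "nat \<Rightarrow> 's" and N :: nat
  assumes odd_N: "odd N" and N_ge_3: "N \<ge> 3"
    and C_eq_iff: "C j = C k \<longleftrightarrow> j mod N = k mod N"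
    and verts_C: "verts G = range C"
    and arcs_C: "(C j, C k) \<in> arcs_ends G \<longleftrightarrow> Suc j mod N = k mod N \<or> Suc k mod N = j mod N"
    and arcs_verts: "(u, v) \<in> arcs_ends G \<Longrightarrow> u \<in> verts G \<and> v \<in> verts G"
begin

lemma C_add_N: "C (k + N) = C k"
  by (simp add: C_eq_iff)

lemma verts_C_window: "verts G = C ` {z..<z + N}"
proof -
  have "C k \<in> C ` {z..<z + N}" for k
  proof -
    \<comment> \<open>The term \<open>z * (N - 1)\<close> stands for \<open>- z\<close> modulo
      \<open>N\<close>; thus \<open>j\<close> is the position congruent to \<open>k\<close> in the
      window starting at \<open>z\<close>, without truncated subtraction.\<close>
    define j where "j = z + (k + z * (N - 1)) mod N"
    have "j mod N = (z + (k + z * (N - 1))) mod N" by (simp add: j_def mod_add_right_eq)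
    also have "z + (k + z * (N - 1)) = k + z * N"
      using N_ge_3 by (cases N) (auto simp: algebra_simps)
    finally have "C j = C k" by (simp add: C_eq_iff)
    moreover have "j \<in> {z..<z + N}" using N_ge_3 by (simp add: j_def)
    ultimately show ?thesis by (metis imageI)
  qed
  then show ?thesis by (auto simp: verts_C)
qed

lemma finite_verts: "finite (verts G)"
  by (simp add: verts_C_window[of 0])

lemma card_verts: "card (verts G) = N"
proof -
  have "inj_on C {0..<0 + N}" by (auto simp: inj_on_def C_eq_iff)
  then show ?thesis by (simp add: verts_C_window[of 0] card_image)
qed

lemma symmetric: "symmetric G"
proof -
  have "(v, u) \<in> arcs_ends G" if "(u, v) \<in> arcs_ends G" for u v
    using that arcs_verts[OF that] by (auto simp: verts_C arcs_C)
  then show ?thesis by (auto simp: symmetric_def intro: symI)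
qed

lemma arcs_sym: "(u, v) \<in> arcs_ends G \<Longrightarrow> (v, u) \<in> arcs_ends G"
  using arcs_ends_symmetric[OF symmetric] .

lemma arc_Suc: "(C k, C (Suc k)) \<in> arcs_ends G"
  by (simp add: arcs_C)

lemma arcE:
  assumes "(u, v) \<in> arcs_ends G"
  obtains k where "u = C k" "v = C (Suc k)" | k where "v = C k" "u = C (Suc k)"
proof -
  obtain j k where jk: "u = C j" "v = C k" using arcs_verts[OF assms] by (auto simp: verts_C)
  then have "C (Suc j) = C k \<or> C (Suc k) = C j" using assms by (simp add: arcs_C C_eq_iff)
  then show ?thesis using jk that by metis
qed

lemma arc_Suc_iff: "(C (Suc k), v) \<in> arcs_ends G \<longleftrightarrow> v = C k \<or> v = C (Suc (Suc k))"
proof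
  have pred: "C j = C k" if "C (Suc j) = C (Suc k)" for j k
    using that mod_Suc_eq[of j N] by (auto simp: C_eq_iff mod_Suc split: if_splits)
  have succ: "C (Suc j) = C (Suc k)" if "C j = C k" for j k
    using that by (auto simp: C_eq_iff mod_Suc)
  assume "(C (Suc k), v) \<in> arcs_ends G"
  then show "v = C k \<or> v = C (Suc (Suc k))"
    by (rule arcE) (use pred succ in metis)+
next
  assume "v = C k \<or> v = C (Suc (Suc k))"
  then show "(C (Suc k), v) \<in> arcs_ends G" using arc_Suc arcs_sym by blast
qed

lemma degree_le_2:
  assumes "(u, v1) \<in> arcs_ends G" "(u, v2) \<in> arcs_ends G" "(u, v3) \<in> arcs_ends G"
  shows "v1 = v2 \<or> v2 = v3 \<or> v1 = v3"
proof -
  obtain j where "u = C j" using arcs_verts[OF assms(1)] by (auto simp: verts_C)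
  \<comment> \<open>Going once round the cycle gives every vertex a successor index, the form that
    \<open>arc_Suc_iff\<close> needs.\<close>
  moreover have "C j = C (Suc (j + N - 1))" using C_add_N[of j] N_ge_3 by simp
  ultimately obtain l where "u = C (Suc l)" by blast
  then show ?thesis using assms by (metis arc_Suc_iff)
qed

section \<open>Odd paths, their separation and their ends\<close>

lemma odd_pathE:
  assumes "I \<in> odd_paths G"
  obtains M p where "odd M" "bij_betw p {..<M} I"
    "\<forall>a<M. \<forall>b<M. (p a, p b) \<in> arcs_ends G \<longleftrightarrow> b = Suc a \<or> a = Suc b"
proof -
  obtain m :: nat and p where p: "bij_betw p {..<2 * m + 1} I"
    "\<forall>a<2*m+1. \<forall>b<2*m+1. (p a, p b) \<in> arcs_ends (G \<restriction> I) \<longleftrightarrow> b = a + 1 \<or> a = b + 1"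
    using assms by (auto simp: odd_paths_def is_path_graph_def)
  have "p a \<in> I" if "a < 2 * m + 1" for a using p(1) that by (auto simp: bij_betw_def)
  then show ?thesis using that[of "2 * m + 1" p] p by (auto simp: arcs_ends_induce_subgraph)
qed

lemma odd_path_connected:
  assumes "I \<in> odd_paths G"
  shows "Digraph_Component.connected (G \<restriction> I)"
proof -
  obtain M p where "odd M" "bij_betw p {..<M} I"
    "\<forall>a<M. \<forall>b<M. (p a, p b) \<in> arcs_ends G \<longleftrightarrow> b = Suc a \<or> a = Suc b"
    using odd_pathE[OF assms] by blast
  then show ?thesis
    using connected_sequence[OF symmetric, of M p] by (auto simp: bij_betw_def odd_pos)
qed

lemma odd_path_cut:
  assumes "I \<in> odd_paths G" "U \<subseteq> I" "U \<noteq> {}"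
    and "\<And>u v. u \<in> U \<Longrightarrow> v \<in> I \<Longrightarrow> (u, v) \<in> arcs_ends G \<Longrightarrow> v \<in> U"
  shows "U = I"
proof -
  have "\<forall>U \<subseteq> I. U \<noteq> {} \<longrightarrow> (\<forall>u \<in> U. \<forall>v \<in> I. (u, v) \<in> arcs_ends G \<longrightarrow> v \<in> U) \<longrightarrow> U = I"
    using odd_path_connected[OF assms(1)] by (simp add: connected_induce_subgraph_iff[OF symmetric])
  then show ?thesis using assms(2-4) by simp
qed

lemma odd_path_nonempty: "I \<in> odd_paths G \<Longrightarrow> I \<noteq> {}"
  using odd_path_connected by (simp add: connected_induce_subgraph_iff[OF symmetric])

text \<open>A closed subset of the union that meets one of the two paths contains it, because paths
  are connected. A single arc between the paths would carry it over to the other one and make the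
  union connected.\<close>

lemma spade_no_arc:
  assumes "I \<in> odd_paths G" "I' \<in> odd_paths G" "spade G I I'" "i \<in> I" "i' \<in> I'"
  shows "(i, i') \<notin> arcs_ends G"
proof
  assume arc: "(i, i') \<in> arcs_ends G"
  have "U = I \<union> I'"
    if U: "U \<subseteq> I \<union> I'" "U \<noteq> {}"
      and cl: "\<forall>u\<in>U. \<forall>v\<in>I \<union> I'. (u, v) \<in> arcs_ends G \<longrightarrow> v \<in> U" for U
  proof -
    have 1: "I \<subseteq> U" if "U \<inter> I \<noteq> {}" using odd_path_cut[OF assms(1), of "U \<inter> I"] cl that by blast
    have 2: "I' \<subseteq> U" if "U \<inter> I' \<noteq> {}" using odd_path_cut[OF assms(2), of "U \<inter> I'"] cl that by blast
    have "i \<in> U \<longleftrightarrow> i' \<in> U" using cl arc arcs_sym assms(4,5) by blast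
    then show ?thesis using 1 2 U assms(4,5) by blast
  qed
  then have "Digraph_Component.connected (G \<restriction> (I \<union> I'))"
    using assms(4) by (auto simp: connected_induce_subgraph_iff[OF symmetric])
  then show False using assms(3) by (simp add: spade_def)
qed

text \<open>Vertices have degree 2, so a vertex of a path with a neighbour outside it is an end.\<close>

lemma path_endsI:
  assumes I: "I \<in> odd_paths G" and i: "i \<in> I" and "i' \<notin> I" and arc: "(i, i') \<in> arcs_ends G"
  shows "i \<in> path_ends G I"
proof -
  obtain M p where p: "odd M" "bij_betw p {..<M} I"
    "\<forall>a<M. \<forall>b<M. (p a, p b) \<in> arcs_ends G \<longleftrightarrow> b = Suc a \<or> a = Suc b"
    using odd_pathE[OF I] by blast
  have inj: "inj_on p {..<M}" and im: "p ` {..<M} = I" using p(2) by (auto simp: bij_betw_def)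
  obtain j where j: "j < M" "i = p j" using im i by blast
  have ends: "j = 0 \<or> Suc j = M"
  proof (rule ccontr)
    assume "\<not> (j = 0 \<or> Suc j = M)"
    then have lt: "j > 0" "Suc j < M" using j by auto
    then have "(i, p (j - 1)) \<in> arcs_ends G" "(i, p (Suc j)) \<in> arcs_ends G"
      using p(3) j by auto
    then have "p (j - 1) = p (Suc j) \<or> p (Suc j) = i' \<or> p (j - 1) = i'"
      using arc by (rule degree_le_2)
    moreover have "p (j - 1) \<in> I" "p (Suc j) \<in> I" using im lt by auto
    ultimately have "p (j - 1) = p (Suc j)" using \<open>i' \<notin> I\<close> by auto
    then have "j - 1 = Suc j" using lt by (intro inj_onD[OF inj]) auto
    then show False by simp
  qed
  have diff: "I - {i} = p ` ({..<M} - {j})"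
    using inj_on_image_set_diff[OF inj, of "{..<M}" "{j}"] j by (simp add: im)
  have "Digraph_Component.connected (G \<restriction> (I - {i}))" if "M > 1"
    using ends
  proof
    assume "j = 0"
    moreover have "{..<M} - {0} = Suc ` {..<M - 1}"
      using that by (auto simp: image_Suc_lessThan)
    ultimately have "I - {i} = (p \<circ> Suc) ` {..<M - 1}" by (simp only: diff image_comp)
    then show ?thesis
      using connected_sequence[OF symmetric, of "M - 1" "p \<circ> Suc"] that p(3) by simp
  next
    assume "Suc j = M"
    then have "{..<M} - {j} = {..<M - 1}" by auto
    then have "I - {i} = p ` {..<M - 1}" by (simp only: diff)
    then show ?thesis
      using connected_sequence[OF symmetric, of "M - 1" p] that p(3) by simp
  qed
  moreover have "I - {i} = {}" if "\<not> M > 1"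
    using that j(1) by (auto simp: diff)
  ultimately show ?thesis using i by (auto simp: path_ends_def)
qed

section \<open>From families of Dyck maps to walks\<close>

definition profile :: "'s set set \<Rightarrow> ('s set \<Rightarrow> 's \<Rightarrow> int) \<Rightarrow> 's \<Rightarrow> int" where
  "profile B f i = (if i \<in> \<Union>B then f (THE I. I \<in> B \<and> i \<in> I) i else 0)"

lemma profile_outside: "i \<notin> \<Union>B \<Longrightarrow> profile B f i = 0"
  by (simp add: profile_def)

lemma phi'_unique:
  assumes "B \<in> phi' G" "I \<in> B" "I' \<in> B" "i \<in> I" "i \<in> I'"
  shows "I = I'"
  using assms unfolding phi'_def spade_def by blast

lemma profile_inside:
  assumes "B \<in> phi' G" "I \<in> B" "i \<in> I"
  shows "profile B f i = f I i"
proof -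
  have "(THE I. I \<in> B \<and> i \<in> I) = I" using assms phi'_unique by (intro the_equality) auto
  then show ?thesis using assms by (auto simp: profile_def)
qed

lemma profile_pos_iff:
  assumes "B \<in> phi' G" "\<And>I. I \<in> B \<Longrightarrow> f I \<in> Dy G I"
  shows "profile B f i \<ge> 0" and "profile B f i > 0 \<longleftrightarrow> i \<in> \<Union>B"
proof -
  have "f I i \<ge> 1" if "I \<in> B" "i \<in> I" for I
    using assms(2)[OF that(1)] that(2) by (auto simp: Dy_def)
  then have "profile B f i \<ge> 1" if "i \<in> \<Union>B"
    using that profile_inside[OF assms(1)] by (metis UnionE)
  then show "profile B f i \<ge> 0" "profile B f i > 0 \<longleftrightarrow> i \<in> \<Union>B"
    using profile_outside[of i B f] by (cases "i \<in> \<Union>B"; simp)+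
qed

text \<open>A neighbour in the same path is covered by the Dyck condition, and one in another path
  is excluded by separation. If the neighbour is in no path, then \<open>i\<close> is an end, so the
  values are 1 and 0.\<close>

lemma profile_arc:
  assumes B: "B \<in> phi' G" and f: "\<And>I. I \<in> B \<Longrightarrow> f I \<in> Dy G I"
    and "I \<in> B" "i \<in> I" and arc: "(i, i') \<in> arcs_ends G"
  shows "\<bar>profile B f i - profile B f i'\<bar> = 1"
proof -
  have I: "I \<in> odd_paths G" using B \<open>I \<in> B\<close> by (auto simp: phi'_def)
  have Pi: "profile B f i = f I i" by (rule profile_inside) fact+
  consider "i' \<in> I" | I' where "I' \<in> B" "i' \<in> I'" "I' \<noteq> I" | "i' \<notin> \<Union>B" by blast
  then show ?thesis
  proof cases
    case 1
    then have "f I i - f I i' \<in> {1, -1}"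
      using f[OF \<open>I \<in> B\<close>] arc \<open>i \<in> I\<close> by (auto simp: Dy_def arcs_ends_induce_subgraph)
    then show ?thesis using Pi profile_inside[OF B \<open>I \<in> B\<close> 1] by auto
  next
    case 2
    then have "spade G I I'" "I' \<in> odd_paths G" using B \<open>I \<in> B\<close> by (auto simp: phi'_def)
    then show ?thesis using spade_no_arc[OF I] 2 \<open>i \<in> I\<close> arc by blast
  next
    case 3
    then have "i \<in> path_ends G I" using path_endsI[OF I \<open>i \<in> I\<close> _ arc] \<open>I \<in> B\<close> by blast
    then have "f I i = 1" using f[OF \<open>I \<in> B\<close>] by (auto simp: Dy_def)
    then show ?thesis using Pi profile_outside[OF 3] by simp
  qed
qed

lemma dyck_walk_profile:
  assumes B: "B \<in> phi' G" and f: "\<And>I. I \<in> B \<Longrightarrow> f I \<in> Dy G I"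
  shows "dyck_walk (\<lambda>k. profile B f (C k))"
  unfolding dyck_walk_def
proof (intro allI conjI)
  fix k
  show "profile B f (C k) \<ge> 0" using profile_pos_iff[of B f] B f by blast
  consider "C k \<in> \<Union>B" | "C (Suc k) \<in> \<Union>B" | "C k \<notin> \<Union>B" "C (Suc k) \<notin> \<Union>B" by blast
  then show "\<bar>profile B f (C (Suc k)) - profile B f (C k)\<bar> = 1 \<or>
      profile B f (C k) = 0 \<and> profile B f (C (Suc k)) = 0"
  proof cases
    case 1
    then show ?thesis using profile_arc[of B f _ "C k" "C (Suc k)"] B f arc_Suc
      by (metis UnionE abs_minus_commute)
  next
    case 2
    then show ?thesis using profile_arc[of B f _ "C (Suc k)" "C k"] B f arc_Suc arcs_sym
      by (metis UnionE)
  qed (simp add: profile_outside)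
qed

text \<open>The members of a separated family are the connected components of its union, so the
  union determines the family.\<close>

lemma phi'_Union_subset:
  assumes B: "B \<in> phi' G" and B': "B' \<in> phi' G" and eq: "\<Union>B = \<Union>B'"
  shows "B \<subseteq> B'"
proof
  fix I assume "I \<in> B"
  \<comment> \<open>Stated for arbitrary families so that it applies in both directions. The part of
    \<open>J\<close> inside \<open>J'\<close> is closed under arcs in \<open>J\<close>: a neighbour
    in a different member of the second family would contradict separation.\<close>
  have sub: "J \<subseteq> J'" if B: "B \<in> phi' G" "B' \<in> phi' G" "\<Union>B = \<Union>B'"
    and J: "J \<in> B" "J' \<in> B'" "i \<in> J" "i \<in> J'" for B B' J J' i
  proof -
    have "v \<in> J'" if uv: "u \<in> J'" "v \<in> J" "(u, v) \<in> arcs_ends G" for u v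
    proof -
      obtain K where K: "K \<in> B'" "v \<in> K" using B(3) J(1) uv(2) by blast
      then have "K = J'"
        using spade_no_arc[of J' K u v] B(2) J(2) uv(1,3) by (auto simp: phi'_def)
      then show ?thesis using K by simp
    qed
    moreover have "J \<in> odd_paths G" using B(1) J(1) by (auto simp: phi'_def)
    ultimately have "J \<inter> J' = J" using J(3,4) by (intro odd_path_cut) auto
    then show ?thesis by blast
  qed
  have "I \<noteq> {}" using B \<open>I \<in> B\<close> by (intro odd_path_nonempty) (auto simp: phi'_def)
  then obtain i where i: "i \<in> I" by blast
  then obtain I' where I': "I' \<in> B'" "i \<in> I'" using eq \<open>I \<in> B\<close> by blast
  have "I = I'"
    using sub[OF B B' eq \<open>I \<in> B\<close> I'(1) i I'(2)] sub[OF B' B eq[symmetric] I'(1) \<open>I \<in> B\<close> I'(2) i]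
    by (rule equalityI)
  then show "I \<in> B'" using I' by simp
qed

section \<open>From walks to families of Dyck maps\<close>

lemma C_inj_window:
  assumes "z \<le> j" "j < z + N" "z \<le> k" "k < z + N" "C j = C k"
  shows "j = k"
proof -
  have "inj_on C {z..<z + N}"
    by (rule eq_card_imp_inj_on) (simp_all add: card_verts flip: verts_C_window)
  then show ?thesis using assms by (auto dest: inj_onD)
qed

text \<open>The cut vertex \<open>C z\<close> is left out, so no arc wraps round the ends of the
  window.\<close>

lemma arcs_C_window:
  assumes "z < j" "j < z + N" "z < k" "k < z + N"
  shows "(C j, C k) \<in> arcs_ends G \<longleftrightarrow> k = Suc j \<or> j = Suc k"
proof -
  have "C (Suc a) = C b \<longleftrightarrow> Suc a = b" if "z < a" "a < z + N" "z < b" "b < z + N" for a b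
    using C_inj_window[of "Suc z" "Suc a" b] that by auto
  then have "C (Suc j) = C k \<or> C (Suc k) = C j \<longleftrightarrow> k = Suc j \<or> j = Suc k" using assms by metis
  then show ?thesis by (simp add: arcs_C C_eq_iff)
qed

text \<open>Cutting the cycle at a zero \<open>C z\<close> of \<open>F\<close> turns the components of the support into
  intervals of positions between consecutive zeros.\<close>

definition gap :: "('s \<Rightarrow> int) \<Rightarrow> nat \<Rightarrow> nat \<Rightarrow> nat \<Rightarrow> bool" where
  "gap F z a b \<longleftrightarrow> z \<le> a \<and> Suc a < b \<and> b \<le> z + N \<and> F (C a) = 0 \<and> F (C b) = 0 \<and>
     (\<forall>k. a < k \<longrightarrow> k < b \<longrightarrow> F (C k) \<noteq> 0)"

lemma gap_cover:
  assumes "F (C z) = 0" and i: "i \<in> verts G" "F i \<noteq> 0"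
  shows "\<exists>a b. gap F z a b \<and> i \<in> C ` {a<..<b}"
proof -
  obtain k where k: "z \<le> k" "k < z + N" "i = C k" using i(1) by (auto simp: verts_C_window[of z])
  have "F (C (z + N)) = 0" using assms(1) by (simp add: C_add_N)
  \<comment> \<open>The last zero up to \<open>k\<close> and the first zero from \<open>k\<close>
    on. Both exist because \<open>C z\<close> and \<open>C (z + N)\<close> are the same vertex, a
    zero of \<open>F\<close>.\<close>
  define a where "a = Max {a. z \<le> a \<and> a \<le> k \<and> F (C a) = 0}"
  define b where "b = Min {b. k \<le> b \<and> b \<le> z + N \<and> F (C b) = 0}"
  have fin: "finite {a. z \<le> a \<and> a \<le> k \<and> F (C a) = 0}" "finite {b. k \<le> b \<and> b \<le> z + N \<and> F (C b) = 0}"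
    by (auto intro: finite_subset[of _ "{..z + N}"] finite_subset[of _ "{..k}"])
  have "a \<in> {a. z \<le> a \<and> a \<le> k \<and> F (C a) = 0}"
    unfolding a_def using fin(1) by (rule Max_in) (use k assms(1) in auto)
  moreover have "b \<in> {b. k \<le> b \<and> b \<le> z + N \<and> F (C b) = 0}"
    unfolding b_def using fin(2) by (rule Min_in) (use k \<open>F (C (z + N)) = 0\<close> in auto)
  ultimately have ab: "z \<le> a" "a \<le> k" "F (C a) = 0" "k \<le> b" "b \<le> z + N" "F (C b) = 0" by auto
  have "a \<noteq> k" "b \<noteq> k" using ab i k by auto
  then have lt: "a < k" "k < b" using ab by auto
  have "F (C l) \<noteq> 0" if "a < l" "l < b" for l
  proof
    assume "F (C l) = 0"
    then have "l \<le> k \<Longrightarrow> l \<le> a" "k \<le> l \<Longrightarrow> b \<le> l"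
      using that ab by (auto simp: a_def b_def fin intro!: Max_ge Min_le)
    then show False using that by linarith
  qed
  then have "gap F z a b" using ab lt by (auto simp: gap_def)
  moreover have "i \<in> C ` {a<..<b}" using k lt by auto
  ultimately show ?thesis by blast
qed

text \<open>If distinct gaps overlapped, an endpoint of one, which is a zero, would lie strictly
  inside the other.\<close>

lemma gap_disjoint:
  assumes "gap F z a b" "gap F z a' b'" "(a, b) \<noteq> (a', b')"
  shows "b \<le> a' \<or> b' \<le> a"
proof (rule ccontr)
  assume "\<not> ?thesis"
  then have lt: "a' < b" "a < b'" by auto
  have zero: "F (C a) = 0" "F (C b) = 0" "F (C a') = 0" "F (C b') = 0"
    and pos: "\<And>k. a < k \<Longrightarrow> k < b \<Longrightarrow> F (C k) \<noteq> 0" "\<And>k. a' < k \<Longrightarrow> k < b' \<Longrightarrow> F (C k) \<noteq> 0"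
    using assms(1,2) by (auto simp: gap_def)
  have "\<not> a < a'" "\<not> a' < a" using zero pos lt by blast+
  then have "a = a'" by simp
  moreover have "a < b" "a' < b'" using assms(1,2) by (auto simp: gap_def)
  ultimately have "\<not> b < b'" "\<not> b' < b" using zero pos by blast+
  then show False using \<open>a = a'\<close> assms(3) by simp
qed

text \<open>Across a gap the values of \<open>F\<close> alternate in parity and are 0 at both ends,
  so \<open>b - a\<close> is even and the number of interior positions is odd.\<close>

lemma gap_odd_path:
  assumes walk: "dyck_walk (\<lambda>k. F (C k))" and gap: "gap F z a b"
  shows "C ` {a<..<b} \<in> odd_paths G"
proof -
  have ab: "z \<le> a" "Suc a < b" "b \<le> z + N" using gap by (auto simp: gap_def)
  have step: "F (C (Suc k)) = F (C k) + 1 \<or> F (C (Suc k)) = F (C k) - 1"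
    if "a \<le> k" "k < b" for k
  proof -
    \<comment> \<open>One of two consecutive positions from \<open>a\<close> to \<open>b\<close> is
      interior, since \<open>Suc a < b\<close>; this excludes stays at 0.\<close>
    have "F (C k) \<noteq> 0 \<or> F (C (Suc k)) \<noteq> 0"
      using gap ab that by (cases "k = a") (auto simp: gap_def)
    moreover have "\<bar>F (C (Suc k)) - F (C k)\<bar> = 1 \<or> F (C k) = 0 \<and> F (C (Suc k)) = 0"
      using walk by (simp add: dyck_walk_def)
    ultimately show ?thesis by linarith
  qed
  have parity: "even (F (C (a + l))) \<longleftrightarrow> even l" if "a + l \<le> b" for l
    using that
  proof (induction l)
    case (Suc l)
    have "even (F (C (Suc (a + l)))) \<longleftrightarrow> odd (F (C (a + l)))" using step[of "a + l"] Suc.prems by auto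
    then show ?case using Suc by simp
  qed (use gap in \<open>simp add: gap_def\<close>)
  have "even (b - a)" using parity[of "b - a"] gap ab by (simp add: gap_def)
  then have "odd (b - Suc a)" using ab by (metis Suc_diff_Suc Suc_lessD even_Suc)
  then obtain m where m: "b - Suc a = 2 * m + 1" by (elim oddE)
  define p where "p j = C (Suc a + j)" for j
  have "inj_on p {..<2 * m + 1}"
  proof (rule inj_onI)
    fix j k assume "j \<in> {..<2 * m + 1}" "k \<in> {..<2 * m + 1}" "p j = p k"
    then show "j = k" using C_inj_window[of z "Suc a + j" "Suc a + k"] ab m by (auto simp: p_def)
  qed
  moreover have im: "p ` {..<2 * m + 1} = C ` {a<..<b}"
  proof -
    have "(\<lambda>j. Suc a + j) ` {..<2 * m + 1} = {Suc a..<Suc a + (2 * m + 1)}"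
      using image_add_atLeastLessThan[of "Suc a" 0 "2 * m + 1"] by (simp add: atLeast0LessThan add.commute)
    also have "\<dots> = {a<..<b}" using m ab by auto
    finally show ?thesis unfolding p_def image_image[of C "\<lambda>j. Suc a + j", symmetric] by (rule arg_cong)
  qed
  moreover have "(p j, p k) \<in> arcs_ends (G \<restriction> (C ` {a<..<b})) \<longleftrightarrow> k = j + 1 \<or> j = k + 1"
    if "j < 2 * m + 1" "k < 2 * m + 1" for j k
  proof -
    have "p j \<in> C ` {a<..<b}" "p k \<in> C ` {a<..<b}" using im that by blast+
    then show ?thesis
      using arcs_C_window[of z "Suc a + j" "Suc a + k"] ab m that
      by (auto simp: p_def arcs_ends_induce_subgraph)
  qed
  ultimately have "is_path_graph (2 * m + 1) (G \<restriction> (C ` {a<..<b}))"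
    unfolding is_path_graph_def bij_betw_def by (intro exI[of _ p]) simp
  then show ?thesis by (auto simp: odd_paths_def verts_C)
qed

text \<open>Deleting a position \<open>k\<close> with interior positions on both sides leaves the
  part to the left of \<open>k\<close> closed under arcs and proper, so the rest is
  disconnected.\<close>

lemma gap_path_ends:
  assumes gap: "gap F z a b" and "i \<in> path_ends G (C ` {a<..<b})"
  shows "i = C (Suc a) \<or> i = C (b - 1)"
proof -
  have ab: "z \<le> a" "Suc a < b" "b \<le> z + N" using gap by (auto simp: gap_def)
  have inj: "j = k" if "a < j" "j < b" "a < k" "k < b" "C j = C k" for j k
    using C_inj_window[of z j k] that ab by auto
  obtain k where k: "a < k" "k < b" "i = C k"
    and conn: "Digraph_Component.connected (G \<restriction> (C ` {a<..<b} - {i})) \<or> C ` {a<..<b} - {i} = {}"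
    using assms(2) by (auto simp: path_ends_def)
  have "k = Suc a \<or> k = b - 1"
  proof (rule ccontr)
    assume *: "\<not> ?thesis"
    then have mid: "Suc a < k" "Suc k < b" using k by auto
    have "inj_on C {a<..<b}" using inj by (auto intro: inj_onI)
    moreover have "{a<..<b} - {k} = {a<..<k} \<union> {k<..<b}" using k by auto
    ultimately have diff: "C ` {a<..<b} - {i} = C ` ({a<..<k} \<union> {k<..<b})"
      using inj_on_image_set_diff[OF _ Diff_subset, of C "{a<..<b}" "{k}"] k by simp
    have "C ` {a<..<k} = C ` ({a<..<k} \<union> {k<..<b})"
    proof -
      have "C (Suc a) \<in> C ` ({a<..<k} \<union> {k<..<b})" using mid by auto
      then have "Digraph_Component.connected (G \<restriction> (C ` ({a<..<k} \<union> {k<..<b})))"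
        using conn unfolding diff by blast
      moreover have "C ` {a<..<k} \<noteq> {}" using mid by auto
      moreover have "v \<in> C ` {a<..<k}"
        if uv: "u \<in> C ` {a<..<k}" "v \<in> C ` ({a<..<k} \<union> {k<..<b})" "(u, v) \<in> arcs_ends G" for u v
      proof -
        obtain j l where jl: "u = C j" "a < j" "j < k" "v = C l" "a < l" "l < b" "l \<noteq> k"
          using uv k by auto
        then have "l = Suc j \<or> j = Suc l" using arcs_C_window[of z j l] uv(3) ab k by auto
        then show ?thesis using jl by auto
      qed
      ultimately show ?thesis
        unfolding connected_induce_subgraph_iff[OF symmetric] by (metis image_mono sup_ge1)
    qed
    moreover have "C (Suc k) \<in> C ` ({a<..<k} \<union> {k<..<b})" using mid by auto
    ultimately have "C (Suc k) \<in> C ` {a<..<k}" by (simp only:)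
    then obtain j where "a < j" "j < k" "C (Suc k) = C j" by auto
    then show False using inj[of "Suc k" j] mid k by auto
  qed
  then show ?thesis using k by blast
qed

lemma gap_Dy:
  assumes walk: "dyck_walk (\<lambda>k. F (C k))" and gap: "gap F z a b"
  shows "restrict F (C ` {a<..<b}) \<in> Dy G (C ` {a<..<b})"
proof -
  have ab: "z \<le> a" "Suc a < b" "b \<le> z + N" using gap by (auto simp: gap_def)
  have nonneg: "F (C k) \<ge> 0"
    and step: "\<bar>F (C (Suc k)) - F (C k)\<bar> = 1 \<or> F (C k) = 0 \<and> F (C (Suc k)) = 0" for k
    using walk by (auto simp: dyck_walk_def)
  have pos: "F (C k) \<ge> 1" if "a < k" "k < b" for k
    using gap nonneg[of k] that by (force simp: gap_def)
  have "F (C a) = 0" "F (C b) = 0" using gap by (auto simp: gap_def)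
  moreover have "a < b - 1" "b - 1 < b" "Suc (b - 1) = b" using ab by auto
  \<comment> \<open>A positive value next to a zero of the walk must be 1.\<close>
  ultimately have ends: "F (C (Suc a)) = 1" "F (C (b - 1)) = 1"
    using step[of a] pos[of "Suc a"] step[of "b - 1"] pos[of "b - 1"] ab by simp_all
  have "F i = 1" if "i \<in> path_ends G (C ` {a<..<b})" for i
    using gap_path_ends[OF gap that] ends by auto
  moreover have "path_ends G (C ` {a<..<b}) \<subseteq> C ` {a<..<b}" by (auto simp: path_ends_def)
  moreover have "F i - F i' \<in> {1, -1}"
    if arc: "i \<in> C ` {a<..<b}" "i' \<in> C ` {a<..<b}" "(i, i') \<in> arcs_ends G" for i i'
  proof -
    obtain j k where jk: "i = C j" "a < j" "j < b" "i' = C k" "a < k" "k < b" using arc(1,2) by auto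
    then have "k = Suc j \<or> j = Suc k" using arcs_C_window[of z j k] arc(3) ab by auto
    then show ?thesis using step[of j] step[of k] pos[of j] pos[of k] jk by auto
  qed
  ultimately show ?thesis
    using pos by (auto simp: Dy_def arcs_ends_induce_subgraph subset_iff)
qed

text \<open>Position \<open>b\<close> lies in neither open interval, so no position of the first is
  consecutive to one of the second, and the first is closed under arcs in the union.\<close>

lemma gap_spade:
  assumes gap: "gap F z a b" "gap F z a' b'" and le: "b \<le> a'"
  shows "spade G (C ` {a<..<b}) (C ` {a'<..<b'})"
proof -
  have ab: "z \<le> a" "Suc a < b" "b \<le> z + N" "z \<le> a'" "Suc a' < b'" "b' \<le> z + N"
    using gap by (auto simp: gap_def)
  have disj: "C ` {a<..<b} \<inter> C ` {a'<..<b'} = {}"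
  proof -
    have "C j \<noteq> C k" if "a < j" "j < b" "a' < k" "k < b'" for j k
      using C_inj_window[of z j k] that ab le by auto
    then show ?thesis by fastforce
  qed
  have "\<not> Digraph_Component.connected (G \<restriction> (C ` {a<..<b} \<union> C ` {a'<..<b'}))"
  proof
    assume "Digraph_Component.connected (G \<restriction> (C ` {a<..<b} \<union> C ` {a'<..<b'}))"
    moreover have "C ` {a<..<b} \<noteq> {}" "C ` {a'<..<b'} \<noteq> {}" using ab by auto
    moreover have "v \<in> C ` {a<..<b}"
      if uv: "u \<in> C ` {a<..<b}" "v \<in> C ` {a<..<b} \<union> C ` {a'<..<b'}" "(u, v) \<in> arcs_ends G" for u v
    proof (rule ccontr)
      assume "v \<notin> C ` {a<..<b}"
      then obtain j k where jk: "u = C j" "a < j" "j < b" "v = C k" "a' < k" "k < b'"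
        using uv by auto
      then have "k = Suc j \<or> j = Suc k" using arcs_C_window[of z j k] uv(3) ab by auto
      then show False using jk le by auto
    qed
    ultimately have "C ` {a<..<b} = C ` {a<..<b} \<union> C ` {a'<..<b'}"
      unfolding connected_induce_subgraph_iff[OF symmetric] by (metis sup_ge1)
    then show False using disj \<open>C ` {a'<..<b'} \<noteq> {}\<close> by blast
  qed
  then show ?thesis using disj by (simp add: spade_def)
qed

lemma spade_commute: "spade G I I' \<longleftrightarrow> spade G I' I"
  by (simp add: spade_def Int_commute Un_commute)

lemma dyck_walk_decomposition:
  assumes walk: "dyck_walk (\<lambda>k. F (C k))"
  obtains B where "B \<in> phi' G" "\<And>I. I \<in> B \<Longrightarrow> restrict F I \<in> Dy G I"
    "\<And>i. i \<in> verts G \<Longrightarrow> i \<notin> \<Union>B \<Longrightarrow> F i = 0"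
proof -
  \<comment> \<open>The odd length of the cycle provides a zero at which to cut it.\<close>
  obtain z where z: "F (C z) = 0" using dyck_walk_zero[OF odd_N walk] by (auto simp: C_add_N)
  define B where "B = {C ` {a<..<b} |a b. gap F z a b}"
  have odd: "B \<subseteq> odd_paths G" using gap_odd_path[OF walk] by (auto simp: B_def)
  then have "B \<subseteq> Pow (verts G)" by (auto simp: odd_paths_def)
  then have "finite B" using finite_verts by (meson finite_Pow_iff finite_subset)
  moreover have "I = I' \<or> spade G I I'" if II': "I \<in> B" "I' \<in> B" for I I'
  proof -
    obtain a b a' b' where gaps: "gap F z a b" "gap F z a' b'"
      and I: "I = C ` {a<..<b}" "I' = C ` {a'<..<b'}"
      using II' by (auto simp: B_def)
    show ?thesis
    proof (cases "(a, b) = (a', b')")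
      case False
      then have "b \<le> a' \<or> b' \<le> a" using gap_disjoint gaps by blast
      then show ?thesis using gap_spade gaps spade_commute unfolding I by blast
    qed (simp add: I)
  qed
  ultimately have "B \<in> phi' G" using odd by (auto simp: phi'_def)
  moreover have "restrict F I \<in> Dy G I" if "I \<in> B" for I
    using that gap_Dy[OF walk] by (auto simp: B_def)
  moreover have "F i = 0" if "i \<in> verts G" "i \<notin> \<Union>B" for i
    using gap_cover[of F z i] z that by (auto simp: B_def)
  ultimately show thesis by (rule that)
qed

end

subsection \<open>Circular bases\<close>

locale circular_space = vector_space scale + cycle_graph "form_graph \<omega> S e" C "2 * n + 1"
  for scale :: "bit \<Rightarrow> 'v \<Rightarrow> 'v::ab_group_add" and \<omega> :: "'v \<Rightarrow> 'v \<Rightarrow> bit"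
    and S :: "'s set" and e :: "'s \<Rightarrow> 'v" and C :: "nat \<Rightarrow> 's" and n :: nat +
  assumes dim: "dim UNIV = 2 * n"
    and symplectic: "symplectic_form scale \<omega>"
    and nondegenerate: "nondegenerate \<omega>"
begin

definition combination :: "('s \<Rightarrow> bit) \<Rightarrow> 'v" where
  "combination x = (\<Sum>i\<in>S. scale (x i) (e i))"

lemma verts_eq: "verts (form_graph \<omega> S e) = S"
  by (simp add: form_graph_def)

lemma finite_S: "finite S"
  using finite_verts by (simp add: verts_eq)

lemma S_eq: "S = range C"
  using verts_C by (simp add: verts_eq)

lemma bit_add_eq_0_iff: "a + b = 0 \<longleftrightarrow> a = b" for a b :: bit
  by (cases a; cases b) simp_all

lemma vector_add_self: "v + v = 0" for v :: 'v
proof -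
  have "v + v = scale (1 + 1) v" by (simp only: scale_left_distrib scale_one)
  then show ?thesis by simp
qed

lemma form_sum_left: "\<omega> (\<Sum>i\<in>A. scale (x i) (f i)) y = (\<Sum>i\<in>A. x i * \<omega> (f i) y)"
proof -
  interpret l: Vector_Spaces.linear scale "(*)" "\<lambda>x. \<omega> x y"
    using symplectic by (simp add: symplectic_form_def)
  show ?thesis by (simp only: l.sum l.scale)
qed

lemma form_sum_right: "\<omega> y (\<Sum>i\<in>A. scale (x i) (f i)) = (\<Sum>i\<in>A. x i * \<omega> y (f i))"
proof -
  interpret l: Vector_Spaces.linear scale "(*)" "\<lambda>x. \<omega> y x"
    using symplectic by (simp add: symplectic_form_def)
  show ?thesis by (simp only: l.sum l.scale)
qed

lemma form_e:
  assumes "i \<in> S" "j \<in> S"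
  shows "\<omega> (e i) (e j) = (if (i, j) \<in> arcs_ends (form_graph \<omega> S e) then 1 else 0)"
proof (cases "i = j")
  case True
  then show ?thesis using symplectic by (simp add: form_graph_def symplectic_form_def)
next
  case False
  then show ?thesis using assms by (simp add: form_graph_def)
qed

text \<open>Pairing with a basis vector sees only the coordinates at its two neighbours, which are
  distinct because the cycle has length at least 3.\<close>

lemma form_combination:
  "\<omega> (combination x) (e (C (Suc k))) = x (C k) + x (C (Suc (Suc k)))"
proof -
  have "\<omega> (combination x) (e (C (Suc k)))
      = (\<Sum>i\<in>S. if (i, C (Suc k)) \<in> arcs_ends (form_graph \<omega> S e) then x i else 0)"
    unfolding combination_def form_sum_left
    by (intro sum.cong) (simp_all add: form_e S_eq)
  also have "\<dots> = (\<Sum>i | i \<in> S \<and> (i, C (Suc k)) \<in> arcs_ends (form_graph \<omega> S e). x i)"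
    using finite_S by (simp add: sum.inter_filter)
  also have "{i. i \<in> S \<and> (i, C (Suc k)) \<in> arcs_ends (form_graph \<omega> S e)} = {C k, C (Suc (Suc k))}"
    using arc_Suc_iff arcs_sym by (auto simp: S_eq)
  also have "(\<Sum>i\<in>\<dots>. x i) = x (C k) + x (C (Suc (Suc k)))"
  proof -
    have "C k \<noteq> C (Suc (Suc k))" using C_inj_window[of k k "Suc (Suc k)"] N_ge_3 by auto
    then show ?thesis by (simp del: add_bit_eq_xor)
  qed
  finally show ?thesis .
qed

text \<open>Pairing a relation with the \<open>e\<close> vectors shows that coordinates two
  positions apart agree; on an odd cycle steps of two reach every vertex.\<close>

lemma combination_eq_0D:
  assumes "combination x = 0" "i \<in> S" "j \<in> S"
  shows "x i = x j"
proof -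
  have "\<omega> 0 y = 0" for y using form_sum_left[of "\<lambda>_. 0" "\<lambda>_. 0" "{}"] by simp
  then have two: "x (C (Suc (Suc k))) = x (C k)" for k
    using form_combination[of x k] assms(1) bit_add_eq_0_iff by metis
  have even_shift: "x (C (k + 2 * l)) = x (C k)" for k l
    by (induction l) (simp_all add: two)
  \<comment> \<open>The shift by \<open>2 * Suc n\<close> is one full turn plus one
    position.\<close>
  have "x (C (Suc k)) = x (C k)" for k
    using even_shift[of k "Suc n"] C_add_N[of "Suc k"] by simp
  then have const: "x (C k) = x (C 0)" for k by (induction k) simp_all
  obtain j' k' where "i = C j'" "j = C k'" using assms(2,3) by (auto simp: S_eq)
  then show ?thesis using const[of j'] const[of k'] by simp
qed

text \<open>Two equal vectors would give a relation supported on two vertices, but relations are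
  constant on at least three. Injectivity allows the passage from indexed families to sets of
  vectors.\<close>

lemma inj_on_e: "inj_on e S"
proof (rule inj_onI, rule ccontr)
  fix i j assume ij: "i \<in> S" "j \<in> S" "e i = e j" "i \<noteq> j"
  define x where "x k = (if k \<in> {i, j} then 1 else 0 :: bit)" for k
  have "combination x = (\<Sum>k\<in>S. if k \<in> {i, j} then e k else 0)"
    unfolding combination_def x_def by (intro sum.cong) auto
  also have "\<dots> = (\<Sum>k\<in>{i, j}. e k)"
    using finite_S ij by (subst sum.inter_restrict[symmetric]) (auto intro: arg_cong2[where f = sum])
  also have "\<dots> = 0" using ij vector_add_self by simp
  finally have "combination x = 0" .
  then have "x k = x i" if "k \<in> S" for k using combination_eq_0D ij that by blast
  then have "S \<subseteq> {i, j}" unfolding x_def by (metis insertI1 subsetI zero_neq_one)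
  then have "card S \<le> card {i, j}" by (intro card_mono) auto
  also have "\<dots> = 2" using ij by simp
  finally show False using card_verts N_ge_3 by (simp add: verts_eq)
qed

text \<open>After dropping \<open>C 0\<close>, a relation among the other vectors has coordinate 0
  at \<open>C 0\<close> and so vanishes. Hence \<open>2 * n\<close> independent vectors remain, and
  they span by dimension.\<close>

lemma combination_surj: "\<exists>x. v = combination x"
proof -
  define T where "T = S - {C 0}"
  have T: "finite T" "T \<subseteq> S" "inj_on e T"
    using finite_S inj_on_e by (auto simp: T_def inj_on_def)
  have sum_T: "(\<Sum>w\<in>e ` T. scale (f w) w) = combination (\<lambda>i. if i = C 0 then 0 else f (e i))" for f
  proof -
    have "(\<Sum>w\<in>e ` T. scale (f w) w) = (\<Sum>i\<in>T. scale (f (e i)) (e i))"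
      using T(3) by (simp add: sum.reindex)
    also have "\<dots> = combination (\<lambda>i. if i = C 0 then 0 else f (e i))"
      unfolding combination_def T_def using finite_S
      by (intro sum.mono_neutral_cong_left) auto
    finally show ?thesis .
  qed
  have "independent (e ` T)"
  proof (rule independent_if_scalars_zero)
    fix f w assume 0: "(\<Sum>w\<in>e ` T. scale (f w) w) = 0" and "w \<in> e ` T"
    then obtain i where i: "i \<in> S" "i \<noteq> C 0" "w = e i" by (auto simp: T_def)
    show "f w = 0"
      using combination_eq_0D[OF 0[unfolded sum_T] i(1), of "C 0"] i S_eq by auto
  qed (use T in simp)
  moreover have "card (e ` T) = 2 * n"
  proof -
    have "C 0 \<in> S" by (simp add: S_eq)
    then show ?thesis using T finite_S card_verts by (simp add: card_image verts_eq T_def)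
  qed
  moreover obtain A where A: "independent A" "UNIV \<subseteq> span A" "card A = 2 * n"
    using basis_exists[of UNIV] dim by metis
  \<comment> \<open>The cardinality \<open>2 * n\<close> is positive because the cycle has at least
    3 vertices, so it forces \<open>A\<close> to be finite.\<close>
  moreover have "finite A" using A(3) N_ge_3 by (intro card_ge_0_finite) simp
  ultimately interpret finite_dimensional_vector_space scale A
    by unfold_locales auto
  have "UNIV \<subseteq> span (e ` T)"
    by (rule card_ge_dim_independent) (use dim \<open>independent (e ` T)\<close> \<open>card (e ` T) = 2 * n\<close> in auto)
  then have "v \<in> range (\<lambda>f. \<Sum>w\<in>e ` T. scale (f w) w)"
    using span_finite[of "e ` T"] T(1) by auto
  then show ?thesis using sum_T by auto
qed

text \<open>Every vertex has two neighbours, so the sum of all \<open>e\<close> vectors is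
  orthogonal to each of them. They span, and the form is nondegenerate.\<close>

lemma combination_one: "combination (\<lambda>_. 1) = 0"
proof -
  have "\<omega> (combination (\<lambda>_. 1)) (e j) = 0" if "j \<in> S" for j
  proof -
    obtain k where "j = C k" using \<open>j \<in> S\<close> S_eq by blast
    moreover have "C k = C (Suc (k + 2 * n))" using C_add_N[of k] by simp
    ultimately show ?thesis using form_combination[of "\<lambda>_. 1" "k + 2 * n"] by simp
  qed
  then have "\<omega> (combination (\<lambda>_. 1)) (combination x) = 0" for x
    by (subst combination_def[of x]) (simp add: form_sum_right)
  then show ?thesis using nondegenerate combination_surj by (metis nondegenerate_def)
qed

lemma combination_add: "combination (\<lambda>i. x i + y i) = combination x + combination y"
  unfolding combination_def by (simp only: scale_left_distrib sum.distrib)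

lemma combination_add_one: "combination (\<lambda>i. x i + 1) = combination x"
  by (simp only: combination_add combination_one add_0_right)

text \<open>The sum of the two coordinate functions is a relation, hence constant on
  \<open>S\<close>; the constants 0 and 1 give the two alternatives.\<close>

lemma combination_eqD:
  assumes "combination x = combination y"
  shows "(\<forall>i\<in>S. x i = y i) \<or> (\<forall>i\<in>S. x i \<noteq> y i)"
proof -
  have "combination (\<lambda>i. x i + y i) = 0" by (simp only: combination_add assms vector_add_self)
  then have "x i + y i = x j + y j" if "i \<in> S" "j \<in> S" for i j
    using combination_eq_0D that by blast
  then show ?thesis by (metis bit_add_eq_0_iff)
qed

lemma combination_cong: "(\<And>i. i \<in> S \<Longrightarrow> x i = y i) \<Longrightarrow> combination x = combination y"
  unfolding combination_def by (rule sum.cong) simp_all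

section \<open>Membership in the pieces\<close>

lemma combination_blocks:
  assumes B: "B \<in> phi' (form_graph \<omega> S e)"
    and inside: "\<And>I i. I \<in> B \<Longrightarrow> i \<in> I \<Longrightarrow> x i = g I i"
    and outside: "\<And>i. i \<in> S \<Longrightarrow> i \<notin> \<Union>B \<Longrightarrow> x i = 0"
  shows "(\<Sum>I\<in>B. \<Sum>i\<in>I. scale (g I i) (e i)) = combination x"
proof -
  have sub: "I \<subseteq> S" if "I \<in> B" for I using B that by (auto simp: phi'_def odd_paths_def verts_eq)
  have "(\<Sum>I\<in>B. \<Sum>i\<in>I. scale (g I i) (e i)) = (\<Sum>I\<in>B. \<Sum>i\<in>I. scale (x i) (e i))"
    using inside by (intro sum.cong) auto
  also have "\<dots> = (\<Sum>i\<in>\<Union>B. scale (x i) (e i))"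
  proof -
    have "\<forall>I\<in>B. finite I" using finite_S sub finite_subset by blast
    moreover have "\<forall>I\<in>B. \<forall>J\<in>B. I \<noteq> J \<longrightarrow> I \<inter> J = {}" using phi'_unique[OF B] by blast
    ultimately show ?thesis by (simp only: sum.Union_disjoint comp_def)
  qed
  also have "\<dots> = combination x"
    unfolding combination_def using finite_S sub outside
    by (intro sum.mono_neutral_left) auto
  finally show ?thesis .
qed

lemma pieceE:
  assumes B: "B \<in> phi' (form_graph \<omega> S e)" and "v \<in> piece scale (form_graph \<omega> S e) e B"
  obtains F where "dyck_walk (\<lambda>k. F (C k))" "\<And>i. F i > 0 \<longleftrightarrow> i \<in> \<Union>B" "v = combination (\<lambda>i. br (F i))"
proof -
  obtain g where g: "g \<in> (\<Pi>\<^sub>E I\<in>B. Dy2 (form_graph \<omega> S e) I)"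
    and v: "v = (\<Sum>I\<in>B. \<Sum>i\<in>I. scale (g I i) (e i))"
    using assms(2) by (auto simp: piece_def)
  have "\<forall>I\<in>B. \<exists>f\<in>Dy (form_graph \<omega> S e) I. \<forall>i\<in>I. g I i = br (f i)"
    using g by (auto simp: Dy2_def PiE_iff)
  then obtain f where f: "\<And>I. I \<in> B \<Longrightarrow> f I \<in> Dy (form_graph \<omega> S e) I"
    and gf: "\<And>I i. I \<in> B \<Longrightarrow> i \<in> I \<Longrightarrow> g I i = br (f I i)"
    by metis
  \<comment> \<open>Since \<open>br 0 = 0\<close>, extending the Dyck maps by 0 adds nothing to the
    vector.\<close>
  have "v = combination (\<lambda>i. br (profile B f i))"
    unfolding v using B
    by (intro combination_blocks) (simp_all add: gf profile_inside profile_outside br_def)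
  then show thesis
    using that[of "profile B f"] dyck_walk_profile[OF B f] profile_pos_iff(2)[OF B f] by blast
qed

lemma ex_piece: "\<exists>B \<in> phi' (form_graph \<omega> S e). v \<in> piece scale (form_graph \<omega> S e) e B"
proof -
  obtain x where x: "v = combination x" using combination_surj by blast
  obtain u where u: "dyck_walk u" "\<And>k. u (k + (2 * n + 1)) = u k"
    and br_u: "(\<forall>k. br (u k) = x (C k)) \<or> (\<forall>k. br (u k) = x (C k) + 1)"
  proof -
    have "x (C (k + (2 * n + 1))) = x (C k)" for k by (simp only: C_add_N)
    then show thesis using dyck_walk_exists[OF odd_N, of "\<lambda>k. x (C k)"] that by blast
  qed
  \<comment> \<open>Any position of \<open>i\<close> would do: \<open>u\<close> is periodic, so its
    value depends only on the vertex.\<close>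
  define F where "F i = u (SOME k. C k = i)" for i
  have u_mod: "u k = u (k mod (2 * n + 1))" for k
  proof -
    have "u (j + l * (2 * n + 1)) = u j" for j l
    proof (induction l)
      case (Suc l)
      have "j + Suc l * (2 * n + 1) = (j + l * (2 * n + 1)) + (2 * n + 1)" by simp
      then show ?case using u(2) Suc by (simp only:)
    qed simp
    from this[of "k mod (2 * n + 1)" "k div (2 * n + 1)"] show ?thesis by (simp only: mod_div_mult_eq)
  qed
  have FC: "F (C k) = u k" for k
  proof -
    have "C (SOME j. C j = C k) = C k" by (rule someI) simp
    then show ?thesis using u_mod unfolding F_def C_eq_iff by metis
  qed
  have "dyck_walk (\<lambda>k. F (C k))" using u(1) by (simp add: FC)
  then obtain B where B: "B \<in> phi' (form_graph \<omega> S e)"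
    "\<And>I. I \<in> B \<Longrightarrow> restrict F I \<in> Dy (form_graph \<omega> S e) I"
    "\<And>i. i \<in> S \<Longrightarrow> i \<notin> \<Union>B \<Longrightarrow> F i = 0"
    using dyck_walk_decomposition[of F] unfolding verts_eq by blast
  define g where "g = (\<lambda>I\<in>B. \<lambda>i\<in>I. br (F i))"
  have "g \<in> (\<Pi>\<^sub>E I\<in>B. Dy2 (form_graph \<omega> S e) I)"
    using B(2) by (auto simp: g_def Dy2_def intro!: bexI[of _ "restrict F _"])
  moreover have "(\<Sum>I\<in>B. \<Sum>i\<in>I. scale (g I i) (e i)) = combination (\<lambda>i. br (F i))"
    using B(1) by (rule combination_blocks) (auto simp: g_def B(3) br_def)
  \<comment> \<open>The possible complementation of \<open>x\<close> does not change the vector, by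
    \<open>combination_add_one\<close>.\<close>
  moreover have "combination (\<lambda>i. br (F i)) = v"
    using br_u
  proof
    assume "\<forall>k. br (u k) = x (C k)"
    then show ?thesis unfolding x by (intro combination_cong) (auto simp: S_eq FC)
  next
    assume "\<forall>k. br (u k) = x (C k) + 1"
    then have "combination (\<lambda>i. br (F i)) = combination (\<lambda>i. x i + 1)"
      by (intro combination_cong) (auto simp: S_eq FC)
    then show ?thesis by (simp only: combination_add_one x)
  qed
  ultimately have "v \<in> piece scale (form_graph \<omega> S e) e B"
    unfolding piece_def by (intro CollectI exI[of _ g]) simp
  then show ?thesis using B(1) by blast
qed

text \<open>Both families yield walks whose brackets represent \<open>v\<close>, hence agree or are
  complementary. By \<open>dyck_walk_unique\<close> the walks coincide, so do their supports, and
  the support determines the family.\<close>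

lemma piece_unique:
  assumes B: "B \<in> phi' (form_graph \<omega> S e)" "v \<in> piece scale (form_graph \<omega> S e) e B"
    and B': "B' \<in> phi' (form_graph \<omega> S e)" "v \<in> piece scale (form_graph \<omega> S e) e B'"
  shows "B = B'"
proof -
  obtain F where F: "dyck_walk (\<lambda>k. F (C k))" "\<And>i. F i > 0 \<longleftrightarrow> i \<in> \<Union>B"
    "v = combination (\<lambda>i. br (F i))"
    by (rule pieceE[OF B]) blast
  obtain F' where F': "dyck_walk (\<lambda>k. F' (C k))" "\<And>i. F' i > 0 \<longleftrightarrow> i \<in> \<Union>B'"
    "v = combination (\<lambda>i. br (F' i))"
    by (rule pieceE[OF B']) blast
  have "(\<forall>k. br (F (C k)) = br (F' (C k))) \<or> (\<forall>k. br (F (C k)) \<noteq> br (F' (C k)))"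
    using combination_eqD[of "\<lambda>i. br (F i)" "\<lambda>i. br (F' i)"] F(3) F'(3) by (auto simp: S_eq)
  then have "(\<lambda>k. F (C k)) = (\<lambda>k. F' (C k))"
    by (intro dyck_walk_unique[OF odd_N F(1) _ F'(1)]) (simp_all only: C_add_N)
  then have eq: "F (C k) = F' (C k)" for k by (rule fun_cong)
  have "\<Union>B \<subseteq> range C" "\<Union>B' \<subseteq> range C"
    using B(1) B'(1) unfolding verts_C[symmetric] phi'_def odd_paths_def by blast+
  then have "\<Union>B = \<Union>B'" using F(2) F'(2) eq by (metis (no_types, lifting) rangeE subsetD subsetI subset_antisym)
  then show ?thesis using phi'_Union_subset B(1) B'(1) by (metis subset_antisym)
qed

end

theorem theorem0p4:
  fixes scale :: "bit \<Rightarrow> 'v \<Rightarrow> 'v::ab_group_add"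
    and \<omega> :: "'v \<Rightarrow> 'v \<Rightarrow> bit"
    and n :: nat
    and S :: "'s set"
    and e :: "'s \<Rightarrow> 'v"
  assumes "n \<ge> 1"
    and "vector_space scale"
    and "vector_space.dim scale UNIV = 2 * n"
    and "symplectic_form scale \<omega>"
    and "nondegenerate \<omega>"
    and "circular_basis \<omega> n S e"
  shows "(\<Union>B \<in> phi' (form_graph \<omega> S e). piece scale (form_graph \<omega> S e) e B) = UNIV \<and>
         disjoint_family_on (piece scale (form_graph \<omega> S e) e) (phi' (form_graph \<omega> S e))"
proof -
  define G where "G = form_graph \<omega> S e"
  define N where "N = 2 * n + 1"
  obtain c where bij: "bij_betw c {..<N} (verts G)"
    and arcs: "\<And>a b. a < N \<Longrightarrow> b < N \<Longrightarrow> (c a, c b) \<in> arcs_ends G \<longleftrightarrow> b = (a + 1) mod N \<or> a = (b + 1) mod N"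
    using assms(6) by (auto simp: circular_basis_def is_cycle_graph_def G_def N_def)
  have N: "N \<ge> 3" "odd N" using assms(1) by (auto simp: N_def)
  then have less: "k mod N < N" for k by simp
  \<comment> \<open>Extends the given numbering periodically, as the locale requires.\<close>
  define C where "C k = c (k mod N)" for k
  have "cycle_graph G C N"
  proof
    show "C j = C k \<longleftrightarrow> j mod N = k mod N" for j k
      using bij less by (auto simp: C_def bij_betw_def dest: inj_onD)
    have "c a \<in> range C" if "a < N" for a
      using that by (metis C_def mod_less rangeI)
    then have "c ` {..<N} \<subseteq> range C" by blast
    moreover have "range C \<subseteq> c ` {..<N}" using less by (auto simp: C_def)
    ultimately show "verts G = range C" using bij_betw_imp_surj_on[OF bij] by blast
    show "(C j, C k) \<in> arcs_ends G \<longleftrightarrow> Suc j mod N = k mod N \<or> Suc k mod N = j mod N" for j k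
      using arcs[OF less less, of j k] by (auto simp: C_def mod_Suc_eq)
    show "u \<in> verts G \<and> v \<in> verts G" if "(u, v) \<in> arcs_ends G" for u v
      using that by (auto simp: G_def form_graph_def)
  qed (use N in auto)
  then have "circular_space scale \<omega> S e C n"
    using assms by (auto simp: circular_space_def circular_space_axioms_def G_def N_def)
  then interpret circular_space scale \<omega> S e C n .
  show ?thesis using ex_piece piece_unique by (auto simp: disjoint_family_on_def)
qed

end
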